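(* There exists an effectively enumerable $T_0$-space $(X,\tau,\alpha)$ such that $\widehat{X_c}$ is a $wn$-family but the Rice–Shapiro theorem fails for its computable elements: there is $K\subseteq X_c$ whose index set $Ix(K)=\{n\mid\bar\gamma(n)\in K\}$ (for a principal computable numbering $\bar\gamma$ of $X_c$) is computably enumerable, while $K$ is not effectively open in $X_c$.
   Context: $W_e$ denotes the $e$-th c.e. set. A topological space $(X,\tau,\alpha)$ with $\alpha:\omega\to$ (a base of $\tau$) is effectively enumerable if (1) there is a computable $g$ with $\alpha(i)\cap\alpha(j)=\bigcup_{n}\alpha(g(i,j,n))$, and (2) $\{i\mid\alpha(i)\neq\emptyset\}$ is c.e. $A_x=\{n\mid x\in\alpha(n)\}$; $x$ is computable if $A_x$ is c.e.; $X_c$ is the set of computable elements; $\widehat{X_c}=\{A_a\mid a\in X_c\}$. A family $S$ of c.e. sets is a $wn$-family if there is a partial computable $\sigma$ with (i) $\sigma(n)\downarrow\Rightarrow W_{\sigma(n)}\in S$, (ii) $W_n\in S\Rightarrow n\in\mathrm{dom}(\sigma)$ and $W_{\sigma(n)}=W_n$. A numbering $\gamma:\omega\to X_c$ is computable if $A_{\gamma(n)}=W_{f(n)}$ for a computable $f$, and principal computable if moreover every computable numbering of $X_c$ equals $\gamma\circ h$ for a computable $h$; when $\widehat{X_c}$ is a $wn$-family such a numbering exists. $K\subseteq X_c$ is effectively open in $X_c$ if $K=X_c\cap\bigcup_{n\in V}\alpha(n)$ for some c.e. $V$. *)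

theory Defs
  imports "HOL-Analysis.Analysis" "HOL-Library.Nat_Bijection"
begin

(* Computability.  Partial recursive functions are presented by programs acting on single
   numbers; several arguments are passed through the Cantor pairing prod_encode. *)

datatype prog =
    Zero | Succ | Left | Right
  | Tuple prog prog | Comp prog prog | Rec prog prog | Mu prog

(* Rec p q on <a,n> is primitive recursion on n with parameter a; q receives <a,<m,y>> with y the
   value at m.  Mu p on x searches for the least n with p <x,n> = 0 such that p <x,m> is defined
   for all m < n. *)
primrec eval :: "prog \<Rightarrow> nat \<Rightarrow> nat option" where
  "eval Zero = (\<lambda>x. Some 0)"
| "eval Succ = (\<lambda>x. Some (Suc x))"
| "eval Left = (\<lambda>x. Some (fst (prod_decode x)))"
| "eval Right = (\<lambda>x. Some (snd (prod_decode x)))"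
| "eval (Tuple p q) = (\<lambda>x. Option.bind (eval p x) (\<lambda>a.
     Option.bind (eval q x) (\<lambda>b. Some (prod_encode (a, b)))))"
| "eval (Comp p q) = (\<lambda>x. Option.bind (eval q x) (eval p))"
| "eval (Rec p q) = (\<lambda>x. let (a, n) = prod_decode x in
     rec_nat (eval p a)
       (\<lambda>m r. Option.bind r (\<lambda>y. eval q (prod_encode (a, prod_encode (m, y))))) n)"
| "eval (Mu p) = (\<lambda>x.
     let P = (\<lambda>n. eval p (prod_encode (x, n)) = Some 0 \<and>
                  (\<forall>m<n. eval p (prod_encode (x, m)) \<noteq> None))
     in if \<exists>n. P n then Some (LEAST n. P n) else None)"

primrec encode :: "prog \<Rightarrow> nat" where
  "encode Zero = 0"
| "encode Succ = 1"
| "encode Left = 2"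
| "encode Right = 3"
| "encode (Tuple p q) = 4 * prod_encode (encode p, encode q) + 4"
| "encode (Comp p q) = 4 * prod_encode (encode p, encode q) + 5"
| "encode (Rec p q) = 4 * prod_encode (encode p, encode q) + 6"
| "encode (Mu p) = 4 * encode p + 7"

lemma inj_encode: "inj encode"
proof (rule injI)
  fix p q show "encode p = encode q \<Longrightarrow> p = q"
  proof (induction p arbitrary: q)
    case Zero then show ?case by (cases q) auto
  next
    case Succ then show ?case by (cases q) auto
  next
    case Left then show ?case by (cases q) auto
  next
    case Right then show ?case by (cases q) auto
  next
    case (Tuple p1 p2)
    then show ?case by (cases q) (simp_all, presburger+)
  next
    case (Comp p1 p2)
    then show ?case by (cases q) (simp_all, presburger+)
  next
    case (Rec p1 p2)
    then show ?case by (cases q) (simp_all, presburger+)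
  next
    case (Mu p)
    then show ?case by (cases q) (simp_all, presburger+)
  qed
qed

lemma surj_encode: "surj encode"
proof -
  have "\<exists>p. encode p = n" for n
  proof (induction n rule: less_induct)
    case (less n)
    show ?case
    proof (cases "n < 4")
      case True
      then have "n = 0 \<or> n = 1 \<or> n = 2 \<or> n = 3" by auto
      then show ?thesis
        by (metis encode.simps(1) encode.simps(2) encode.simps(3) encode.simps(4))
    next
      case False
      define k where "k = (n - 4) div 4"
      obtain a b where ab: "prod_encode (a, b) = k"
        by (metis prod_decode_inverse surj_pair)
      have "k < n" using False unfolding k_def by simp
      moreover have "a \<le> k" "b \<le> k"
        using le_prod_encode_1[of a b] le_prod_encode_2[of b a] ab by simp_all
      ultimately obtain p q r where pqr: "encode p = a" "encode q = b" "encode r = k"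
        using less.IH by (meson le_less_trans)
      have "n = 4 * k + 4 \<or> n = 4 * k + 5 \<or> n = 4 * k + 6 \<or> n = 4 * k + 7"
        using False unfolding k_def by presburger
      then show ?thesis
        by (metis ab pqr encode.simps(5) encode.simps(6) encode.simps(7) encode.simps(8))
    qed
  qed
  then show ?thesis by (metis surjI)
qed

lemma bij_encode: "bij encode"
  by (simp add: bij_def inj_encode surj_encode)

definition decode :: "nat \<Rightarrow> prog" where
  "decode = inv encode"

definition W :: "nat \<Rightarrow> nat set" where
  "W e = dom (eval (decode e))"

definition ce :: "nat set \<Rightarrow> bool" where
  "ce A \<longleftrightarrow> (\<exists>e. A = W e)"

definition partial_computable :: "(nat \<Rightarrow> nat option) \<Rightarrow> bool" where
  "partial_computable f \<longleftrightarrow> (\<exists>p. f = eval p)"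

definition computable :: "(nat \<Rightarrow> nat) \<Rightarrow> bool" where
  "computable f \<longleftrightarrow> partial_computable (\<lambda>x. Some (f x))"

definition computable3 :: "(nat \<Rightarrow> nat \<Rightarrow> nat \<Rightarrow> nat) \<Rightarrow> bool" where
  "computable3 g \<longleftrightarrow> (\<exists>f. computable f \<and>
     (\<forall>i j n. g i j n = f (prod_encode (i, prod_encode (j, n)))))"

definition wn_family :: "nat set set \<Rightarrow> bool" where
  "wn_family S \<longleftrightarrow> (\<forall>A\<in>S. ce A) \<and>
     (\<exists>\<sigma>. partial_computable \<sigma> \<and>
       (\<forall>n m. \<sigma> n = Some m \<longrightarrow> W m \<in> S) \<and>
       (\<forall>n. W n \<in> S \<longrightarrow> (\<exists>m. \<sigma> n = Some m \<and> W m = W n)))"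

(* The first conjunct says that the range of \<alpha> is a base of the topology. *)
definition effectively_enumerable :: "'a topology \<Rightarrow> (nat \<Rightarrow> 'a set) \<Rightarrow> bool" where
  "effectively_enumerable X \<alpha> \<longleftrightarrow>
     openin X = arbitrary union_of (\<lambda>U. U \<in> range \<alpha>) \<and>
     (\<exists>g. computable3 g \<and> (\<forall>i j. \<alpha> i \<inter> \<alpha> j = (\<Union>n. \<alpha> (g i j n)))) \<and>
     ce {i. \<alpha> i \<noteq> {}}"

definition base_indices :: "(nat \<Rightarrow> 'a set) \<Rightarrow> 'a \<Rightarrow> nat set" where
  "base_indices \<alpha> x = {n. x \<in> \<alpha> n}"

definition computable_points :: "'a topology \<Rightarrow> (nat \<Rightarrow> 'a set) \<Rightarrow> 'a set" where
  "computable_points X \<alpha> = {x \<in> topspace X. ce (base_indices \<alpha> x)}"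

definition point_family :: "'a topology \<Rightarrow> (nat \<Rightarrow> 'a set) \<Rightarrow> nat set set" where
  "point_family X \<alpha> = base_indices \<alpha> ` computable_points X \<alpha>"

(* As usual in the theory of numberings, a numbering of a set is a map onto it. *)
definition computable_numbering ::
    "'a topology \<Rightarrow> (nat \<Rightarrow> 'a set) \<Rightarrow> (nat \<Rightarrow> 'a) \<Rightarrow> bool" where
  "computable_numbering X \<alpha> \<gamma> \<longleftrightarrow> range \<gamma> = computable_points X \<alpha> \<and>
     (\<exists>f. computable f \<and> (\<forall>n. base_indices \<alpha> (\<gamma> n) = W (f n)))"

definition principal_computable_numbering ::
    "'a topology \<Rightarrow> (nat \<Rightarrow> 'a set) \<Rightarrow> (nat \<Rightarrow> 'a) \<Rightarrow> bool" where
  "principal_computable_numbering X \<alpha> \<gamma> \<longleftrightarrow> computable_numbering X \<alpha> \<gamma> \<and>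
     (\<forall>\<delta>. computable_numbering X \<alpha> \<delta> \<longrightarrow> (\<exists>h. computable h \<and> \<delta> = \<gamma> \<circ> h))"

definition index_set :: "(nat \<Rightarrow> 'a) \<Rightarrow> 'a set \<Rightarrow> nat set" where
  "index_set \<gamma> K = {n. \<gamma> n \<in> K}"

definition effectively_open_in_points ::
    "'a topology \<Rightarrow> (nat \<Rightarrow> 'a set) \<Rightarrow> 'a set \<Rightarrow> bool" where
  "effectively_open_in_points X \<alpha> K \<longleftrightarrow>
     (\<exists>V. ce V \<and> K = computable_points X \<alpha> \<inter> (\<Union>n\<in>V. \<alpha> n))"

end

(* The points are certain c.e. sets, and the n-th basic open set consists of the points containing n.
   A chain of finite approximations {1, 3, ..., x - 1} has the limit of all odd numbers, and the even
   number x turns its approximation into a point base x; the whole set of natural numbers lies above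
   everything. The even numbers x allowed here are those outside a simple set, built so that every
   index e of base x satisfies x < 4 e + 3. Hence a point given by an index e which shows the odd
   number 4 e + 3 is the limit or the whole set, so that K = {limit, whole set} has a c.e. index set
   although every neighbourhood of the limit contains points base x outside K.

   The same observation turns an arbitrary index e into an index of a point: wait until W e
   shows 4 e + 3 (guess: limit) or an even number x (guess: base x), enumerate the guess, and pass to
   the whole set if W e exceeds the guess or x enters the simple set. *)

theory Submission
  imports Defs
begin

section \<open>Computable functions and decidable predicates\<close>

abbreviation pair :: "nat \<Rightarrow> nat \<Rightarrow> nat" where
  "pair a b \<equiv> prod_encode (a, b)"

abbreviation pfst :: "nat \<Rightarrow> nat" where
  "pfst x \<equiv> fst (prod_decode x)"

abbreviation psnd :: "nat \<Rightarrow> nat" where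
  "psnd x \<equiv> snd (prod_decode x)"

definition decidable :: "(nat \<Rightarrow> bool) \<Rightarrow> bool" where
  "decidable P \<longleftrightarrow> computable (\<lambda>x. of_bool (P x))"

lemma computable_iff: "computable f \<longleftrightarrow> (\<exists>p. \<forall>x. eval p x = Some (f x))"
  unfolding computable_def partial_computable_def by (metis ext)

text \<open>There is no identity program, but splitting a number as a pair and rebuilding it returns
  it, since \<open>prod_encode\<close> is a bijection.\<close>

lemma computable_id: "computable (\<lambda>x. x)"
  unfolding computable_iff by (intro exI[of _ "Tuple Left Right"]) simp

lemma computable_comp:
  assumes "computable f" "computable g"
  shows "computable (\<lambda>x. f (g x))"
proof -
  obtain p q where "\<forall>x. eval p x = Some (f x)" "\<forall>x. eval q x = Some (g x)"
    using assms unfolding computable_iff by blast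
  then have "\<forall>x. eval (Comp p q) x = Some (f (g x))" by simp
  then show ?thesis unfolding computable_iff by blast
qed

lemma computable_Suc: "computable f \<Longrightarrow> computable (\<lambda>x. Suc (f x))"
  by (rule computable_comp[of Suc]) (auto simp: computable_iff intro: exI[of _ Succ])

lemma computable_pfst: "computable f \<Longrightarrow> computable (\<lambda>x. pfst (f x))"
  by (rule computable_comp[of pfst]) (auto simp: computable_iff intro: exI[of _ Left])

lemma computable_psnd: "computable f \<Longrightarrow> computable (\<lambda>x. psnd (f x))"
  by (rule computable_comp[of psnd]) (auto simp: computable_iff intro: exI[of _ Right])

lemma computable_pair:
  assumes "computable f" "computable g"
  shows "computable (\<lambda>x. pair (f x) (g x))"
proof -
  obtain p q where "\<forall>x. eval p x = Some (f x)" "\<forall>x. eval q x = Some (g x)"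
    using assms unfolding computable_iff by blast
  then have "\<forall>x. eval (Tuple p q) x = Some (pair (f x) (g x))" by simp
  then show ?thesis unfolding computable_iff by blast
qed

primrec const_prog :: "nat \<Rightarrow> prog" where
  "const_prog 0 = Zero"
| "const_prog (Suc n) = Comp Succ (const_prog n)"

lemma eval_const_prog: "eval (const_prog n) x = Some n"
  by (induction n) auto

lemma computable_const: "computable (\<lambda>x. n)"
  unfolding computable_iff using eval_const_prog by blast

text \<open>The parameter handed to \<open>Rec\<close> is the whole argument \<open>x\<close>, so
  the step function may depend on it. Arithmetic, conditionals and bounded quantifiers below are
  recursions of this kind.\<close>

lemma computable_rec_nat:
  assumes "computable g" "computable n"
    and "computable (\<lambda>z. h (pfst z) (pfst (psnd z)) (psnd (psnd z)))"
  shows "computable (\<lambda>x. rec_nat (g x) (h x) (n x))"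
proof -
  obtain p q r where p: "\<And>x. eval p x = Some (g x)" and q: "\<And>x. eval q x = Some (n x)"
    and r: "\<And>z. eval r z = Some (h (pfst z) (pfst (psnd z)) (psnd (psnd z)))"
    using assms unfolding computable_iff by metis
  have "rec_nat (Some (g x)) (\<lambda>m u. Option.bind u (\<lambda>y. eval r (pair x (pair m y)))) k
      = Some (rec_nat (g x) (h x) k)" for x k
    by (induction k) (auto simp: r)
  then have "\<forall>x. eval (Comp (Rec p r) (Tuple (Tuple Left Right) q)) x
      = Some (rec_nat (g x) (h x) (n x))"
    by (simp add: p q)
  then show ?thesis unfolding computable_iff by blast
qed

lemma computable_add:
  assumes "computable f" "computable g"
  shows "computable (\<lambda>x. f x + g x)"
proof -
  have "rec_nat a (\<lambda>m y. Suc y) b = a + b" for a b :: nat by (induction b) auto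
  moreover have "computable (\<lambda>x. rec_nat (f x) (\<lambda>m y. Suc y) (g x))"
    by (intro computable_rec_nat computable_Suc computable_psnd computable_id assms)
  ultimately show ?thesis by simp
qed

lemma computable_pred:
  assumes "computable f"
  shows "computable (\<lambda>x. f x - 1)"
proof -
  have "rec_nat 0 (\<lambda>m y. m) b = b - 1" for b :: nat by (cases b) auto
  moreover have "computable (\<lambda>x. rec_nat 0 (\<lambda>m y. m) (f x))"
    by (intro computable_rec_nat computable_const computable_pfst computable_psnd
        computable_id assms)
  ultimately show ?thesis by simp
qed

lemma computable_diff:
  assumes "computable f" "computable g"
  shows "computable (\<lambda>x. f x - g x)"
proof -
  have "rec_nat a (\<lambda>m y. y - 1) b = a - b" for a b :: nat by (induction b) auto
  moreover have "computable (\<lambda>x. rec_nat (f x) (\<lambda>m y. y - 1) (g x))"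
    by (intro computable_rec_nat computable_pred computable_psnd computable_id assms)
  ultimately show ?thesis by simp
qed

text \<open>The truth value serves as the length of a recursion with 0 or 1 rounds.\<close>

lemma computable_if:
  assumes "decidable P" "computable f" "computable g"
  shows "computable (\<lambda>x. if P x then f x else g x)"
proof -
  have "rec_nat b (\<lambda>m y. a) (of_bool c) = (if c then a else b)" for a b :: nat and c
    by auto
  moreover have "computable (\<lambda>x. rec_nat (g x) (\<lambda>m y. f x) (of_bool (P x)))"
    using assms(1,3) computable_comp[OF assms(2) computable_pfst[OF computable_id]]
    unfolding decidable_def by (intro computable_rec_nat)
  ultimately show ?thesis by simp
qed

lemma decidable_comp: "decidable P \<Longrightarrow> computable f \<Longrightarrow> decidable (\<lambda>x. P (f x))"
  unfolding decidable_def by (rule computable_comp)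

lemma decidable_not:
  assumes "decidable P"
  shows "decidable (\<lambda>x. \<not> P x)"
proof -
  have "(\<lambda>x. of_bool (\<not> P x)) = (\<lambda>x. if P x then 0 else 1::nat)" by auto
  then show ?thesis
    unfolding decidable_def using computable_if[OF assms computable_const computable_const] by simp
qed

lemma decidable_conj:
  assumes "decidable P" "decidable Q"
  shows "decidable (\<lambda>x. P x \<and> Q x)"
proof -
  have "(\<lambda>x. of_bool (P x \<and> Q x)) = (\<lambda>x. if P x then of_bool (Q x) else 0::nat)" by auto
  then show ?thesis
    using assms computable_if[OF assms(1) _ computable_const] unfolding decidable_def by simp
qed

lemma decidable_disj:
  assumes "decidable P" "decidable Q"
  shows "decidable (\<lambda>x. P x \<or> Q x)"
  using decidable_not[OF decidable_conj[OF decidable_not decidable_not]] assms by simp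

lemma decidable_less:
  assumes "computable f" "computable g"
  shows "decidable (\<lambda>x. f x < g x)"
proof -
  \<comment> \<open>Truncated subtraction is positive exactly if \<open>a < b\<close>, and this
    recursion is the sign function.\<close>
  have "rec_nat 0 (\<lambda>m y. Suc 0) (b - a) = of_bool (a < b)" for a b :: nat
    by (cases "b - a") auto
  moreover have "computable (\<lambda>x. rec_nat 0 (\<lambda>m y. Suc 0) (g x - f x))"
    by (intro computable_rec_nat computable_const computable_diff assms)
  ultimately show ?thesis by (simp add: decidable_def)
qed

lemma decidable_eq:
  assumes "computable f" "computable g"
  shows "decidable (\<lambda>x. f x = g x)"
proof -
  have "decidable (\<lambda>x. \<not> f x < g x \<and> \<not> g x < f x)"
    by (intro decidable_conj decidable_not decidable_less assms)
  then show ?thesis by (simp add: linorder_class.not_less antisym_conv eq_iff conj_commute)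
qed

lemma decidable_odd:
  assumes "computable f"
  shows "decidable (\<lambda>x. odd (f x))"
proof -
  have "rec_nat 0 (\<lambda>m y. Suc 0 - y) a = of_bool (odd a)" for a :: nat
    by (induction a) auto
  moreover have "computable (\<lambda>x. rec_nat 0 (\<lambda>m y. Suc 0 - y) (f x))"
    by (intro computable_rec_nat computable_const computable_diff computable_psnd
        computable_id assms)
  ultimately show ?thesis by (simp add: decidable_def)
qed

lemma decidable_ball_less:
  assumes "computable n" "decidable (\<lambda>z. P (pfst z) (psnd z))"
  shows "decidable (\<lambda>x. \<forall>i<n x. P x i)"
proof -
  have "rec_nat (Suc 0) (\<lambda>m y. if P x m then y else 0) k = of_bool (\<forall>i<k. P x i)" for x k
    by (induction k) (auto simp: less_Suc_eq)
  moreover have "computable (\<lambda>x. rec_nat (Suc 0) (\<lambda>m y. if P x m then y else 0) (n x))"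
  proof (intro computable_rec_nat computable_if computable_const assms(1))
    have "decidable (\<lambda>z. (\<lambda>z. P (pfst z) (psnd z)) (pair (pfst z) (pfst (psnd z))))"
      by (intro decidable_comp[OF assms(2)] computable_pair computable_pfst computable_psnd
          computable_id)
    then show "decidable (\<lambda>z. P (pfst z) (pfst (psnd z)))" by simp
  qed (intro computable_psnd computable_id)
  ultimately show ?thesis by (simp add: decidable_def)
qed

text \<open>Codes of compound programs carry their constructor in the residue modulo 4 and their
  subprograms in a quotient by 4; the machine has to read both.\<close>

lemma computable_mod4:
  assumes "computable f"
  shows "computable (\<lambda>x. f x mod 4)"
proof -
  have "rec_nat 0 (\<lambda>m y. if y = 3 then 0 else Suc y) a = a mod 4" for a :: nat
    by (induction a) (auto simp: mod_Suc)
  moreover have "computable (\<lambda>x. rec_nat 0 (\<lambda>m y. if y = 3 then 0 else Suc y) (f x))"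
    by (intro computable_rec_nat computable_const computable_if decidable_eq computable_Suc
        computable_psnd computable_id assms)
  ultimately show ?thesis by simp
qed

lemma computable_div4:
  assumes "computable f"
  shows "computable (\<lambda>x. f x div 4)"
proof -
  have "rec_nat 0 (\<lambda>m y. if m mod 4 = 3 then Suc y else y) a = a div 4" for a :: nat
    by (induction a) (auto simp: div_Suc mod_Suc)
  moreover have "computable (\<lambda>x. rec_nat 0 (\<lambda>m y. if m mod 4 = 3 then Suc y else y) (f x))"
    by (intro computable_rec_nat computable_const computable_if decidable_eq computable_Suc
        computable_mod4 computable_pfst computable_psnd computable_id assms)
  ultimately show ?thesis by simp
qed

lemmas computable_intros =
  computable_id computable_const computable_Suc computable_pfst computable_psnd computable_pair
  computable_add computable_diff computable_mod4 computable_div4 computable_if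
  decidable_not decidable_conj decidable_disj decidable_less decidable_eq decidable_odd

section \<open>A universal machine\<close>

text \<open>A state is a triple \<open>\<langle>c, \<langle>v, k\<rangle>\<rangle>\<close> with a stack \<open>k\<close> of pending tasks. If \<open>c = Suc e\<close>, the program
  with code \<open>e\<close> is about to be run on \<open>v\<close>; if \<open>c = 0\<close>, the value \<open>v\<close> is returned to the topmost
  task.\<close>

definition push :: "nat \<Rightarrow> nat \<Rightarrow> nat \<Rightarrow> nat" where
  "push t d k = Suc (pair t (pair d k))"

definition run_state :: "nat \<Rightarrow> nat \<Rightarrow> nat \<Rightarrow> nat" where
  "run_state e v k = pair (Suc e) (pair v k)"

definition ret_state :: "nat \<Rightarrow> nat \<Rightarrow> nat" where
  "ret_state v k = pair 0 (pair v k)"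

text \<open>For a compound program, \<open>s\<close> is the number packed by \<open>encode\<close>:
  the code of the body for \<open>Mu\<close>, the pair of the codes \<open>a\<close> and
  \<open>b\<close> otherwise.\<close>

definition step_run :: "nat \<Rightarrow> nat \<Rightarrow> nat \<Rightarrow> nat" where
  "step_run e v k = (let s = (e - 4) div 4; a = pfst s; b = psnd s in
     if e = 0 then ret_state 0 k
     else if e = 1 then ret_state (Suc v) k
     else if e = 2 then ret_state (pfst v) k
     else if e = 3 then ret_state (psnd v) k
     else if e mod 4 = 0 then run_state a v (push 0 (pair b v) k)
     else if e mod 4 = 1 then run_state b v (push 2 a k)
     else if e mod 4 = 2 then
       run_state a (pfst v) (push 3 (pair b (pair (pfst v) (pair 0 (psnd v)))) k)
     else run_state s (pair v 0) (push 4 (pair s (pair v 0)) k))"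

text \<open>Tags of tasks: 0 and 1 await the first and the second component of a
  \<open>Tuple\<close>, 2 the inner value of a \<open>Comp\<close>. Tag 3 is a \<open>Rec\<close>
  with value \<open>v\<close> at round \<open>m\<close> and \<open>j\<close> rounds left. The
  remaining tag, pushed as 4, is a \<open>Mu\<close> that has just tested \<open>m\<close>.\<close>

definition step_ret :: "nat \<Rightarrow> nat \<Rightarrow> nat \<Rightarrow> nat \<Rightarrow> nat" where
  "step_ret v t d k =
    (if t = 0 then run_state (pfst d) (psnd d) (push 1 v k)
     else if t = 1 then ret_state (pair d v) k
     else if t = 2 then run_state d v k
     else if t = 3 then
       (let q = pfst d; a = pfst (psnd d); m = pfst (psnd (psnd d)); j = psnd (psnd (psnd d)) in
        if j = 0 then ret_state v k
        else run_state q (pair a (pair m v)) (push 3 (pair q (pair a (pair (Suc m) (j - 1)))) k))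
     else
       (let p = pfst d; x = pfst (psnd d); m = psnd (psnd d) in
        if v = 0 then ret_state m k
        else run_state p (pair x (Suc m)) (push 4 (pair p (pair x (Suc m))) k)))"

text \<open>A nonempty stack is a successor, so \<open>k = 0\<close> means that no task is pending.
  Such a return state is left unchanged, hence a finished computation stays finished.\<close>

definition step :: "nat \<Rightarrow> nat" where
  "step w = (let c = pfst w; v = pfst (psnd w); k = psnd (psnd w) in
     if c \<noteq> 0 then step_run (c - 1) v k
     else if k = 0 then w
     else step_ret v (pfst (k - 1)) (pfst (psnd (k - 1))) (psnd (psnd (k - 1))))"

lemma computable_push:
  assumes "computable t" "computable d" "computable k"
  shows "computable (\<lambda>x. push (t x) (d x) (k x))"
  unfolding push_def by (intro computable_intros assms)

lemma computable_run_state: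
  assumes "computable e" "computable v" "computable k"
  shows "computable (\<lambda>x. run_state (e x) (v x) (k x))"
  unfolding run_state_def by (intro computable_intros assms)

lemma computable_ret_state:
  assumes "computable v" "computable k"
  shows "computable (\<lambda>x. ret_state (v x) (k x))"
  unfolding ret_state_def by (intro computable_intros assms)

lemmas computable_state_intros =
  computable_push computable_run_state computable_ret_state computable_intros

lemma computable_step_run:
  assumes "computable e" "computable v" "computable k"
  shows "computable (\<lambda>x. step_run (e x) (v x) (k x))"
  unfolding step_run_def Let_def by (intro computable_state_intros assms)

lemma computable_step_ret:
  assumes "computable v" "computable t" "computable d" "computable k"
  shows "computable (\<lambda>x. step_ret (v x) (t x) (d x) (k x))"
  unfolding step_ret_def Let_def by (intro computable_state_intros assms)

lemma computable_step: "computable (\<lambda>w. step w)"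
  unfolding step_def Let_def
  by (intro computable_step_run computable_step_ret computable_state_intros)

lemma step_push:
  "step (ret_state v (push t d k)) = step_ret v t d k"
  "step (ret_state v 0) = ret_state v 0"
  by (simp_all add: step_def ret_state_def push_def)

lemma step_run_state: "step (run_state e v k) = step_run e v k"
  by (simp add: step_def run_state_def)

lemma step_encode:
  "step (run_state (encode Zero) v k) = ret_state 0 k"
  "step (run_state (encode Succ) v k) = ret_state (Suc v) k"
  "step (run_state (encode Left) v k) = ret_state (pfst v) k"
  "step (run_state (encode Right) v k) = ret_state (psnd v) k"
  "step (run_state (encode (Tuple p q)) v k) =
     run_state (encode p) v (push 0 (pair (encode q) v) k)"
  "step (run_state (encode (Comp p q)) v k) = run_state (encode q) v (push 2 (encode p) k)"
  "step (run_state (encode (Rec p q)) v k) = run_state (encode p) (pfst v)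
     (push 3 (pair (encode q) (pair (pfst v) (pair 0 (psnd v)))) k)"
  "step (run_state (encode (Mu p)) v k) =
     run_state (encode p) (pair v 0) (push 4 (pair (encode p) (pair v 0)) k)"
proof -
  have "(4 * k + 4) mod 4 = 0" "(4 * k + 5) mod 4 = 1" "(4 * k + 6) mod 4 = 2"
    "(4 * k + 7) mod 4 = 3" "(4 * k + 4 - 4) div 4 = k" "(4 * k + 5 - 4) div 4 = k"
    "(4 * k + 6 - 4) div 4 = k" "(4 * k + 7 - 4) div 4 = k" for k :: nat
    by presburger+
  note arith = this
  show
    "step (run_state (encode Zero) v k) = ret_state 0 k"
    "step (run_state (encode Succ) v k) = ret_state (Suc v) k"
    "step (run_state (encode Left) v k) = ret_state (pfst v) k"
    "step (run_state (encode Right) v k) = ret_state (psnd v) k"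
    by (simp_all add: step_run_state step_run_def)
  show
    "step (run_state (encode (Tuple p q)) v k) =
      run_state (encode p) v (push 0 (pair (encode q) v) k)"
    "step (run_state (encode (Comp p q)) v k) = run_state (encode q) v (push 2 (encode p) k)"
    "step (run_state (encode (Rec p q)) v k) = run_state (encode p) (pfst v)
      (push 3 (pair (encode q) (pair (pfst v) (pair 0 (psnd v)))) k)"
    "step (run_state (encode (Mu p)) v k) =
      run_state (encode p) (pair v 0) (push 4 (pair (encode p) (pair v 0)) k)"
    unfolding step_run_state step_run_def Let_def encode.simps arith prod_encode_inverse fst_conv snd_conv
    by simp_all
qed

section \<open>Agreement of the machine with \<open>eval\<close>\<close>

definition halts_in :: "nat \<Rightarrow> nat \<Rightarrow> bool" where
  "halts_in n w \<longleftrightarrow> pfst ((step ^^ n) w) = 0 \<and> psnd (psnd ((step ^^ n) w)) = 0"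

lemma halts_in_0: "halts_in 0 w \<longleftrightarrow> pfst w = 0 \<and> psnd (psnd w) = 0"
  by (simp add: halts_in_def)

lemma halts_in_Suc: "halts_in (Suc n) w \<longleftrightarrow> halts_in n (step w)"
  by (simp add: halts_in_def funpow_Suc_right del: funpow.simps)

lemma halts_in_mono:
  assumes "halts_in m w" "m \<le> n"
  shows "halts_in n w"
  using assms(2,1)
proof (induction n rule: dec_induct)
  case (step n)
  then have "step ((step ^^ n) w) = (step ^^ n) w"
    by (simp add: halts_in_def step_def Let_def)
  then show ?case using step by (simp add: halts_in_def)
qed

lemma halts_in_runD:
  "halts_in n (run_state e v k) \<Longrightarrow> 0 < n \<and> halts_in (n - 1) (step (run_state e v k))"
  by (cases n) (simp_all add: halts_in_Suc halts_in_0 run_state_def)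

lemma halts_in_pushD:
  "halts_in n (ret_state v (push t d k)) \<Longrightarrow> 0 < n \<and> halts_in (n - 1) (step_ret v t d k)"
  by (cases n) (simp_all only: halts_in_Suc step_push, simp_all add: halts_in_0 ret_state_def push_def)

definition halts :: "nat \<Rightarrow> bool" where
  "halts w \<longleftrightarrow> (\<exists>n. halts_in n w)"

lemma halts_step: "halts (step w) \<Longrightarrow> halts w"
  unfolding halts_def using halts_in_Suc by blast

abbreviation rec_value :: "prog \<Rightarrow> prog \<Rightarrow> nat \<Rightarrow> nat \<Rightarrow> nat option" where
  "rec_value p q a n \<equiv> rec_nat (eval p a)
     (\<lambda>m r. Option.bind r (\<lambda>y. eval q (pair a (pair m y)))) n"

text \<open>Used contrapositively: if the final value of a recursion is defined, so are all
  intermediate ones.\<close>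

lemma rec_value_add_None: "rec_value p q a m = None \<Longrightarrow> rec_value p q a (m + j) = None"
  by (induction j) auto

text \<open>The stack \<open>k\<close> is arbitrary so that the induction hypotheses apply to
  subprograms running on top of a pushed task. Halting is pulled back from the return state, one
  machine step at a time, by \<open>halts_step\<close>.\<close>

lemma halts_run:
  "eval p x = Some y \<Longrightarrow> halts (ret_state y k) \<Longrightarrow> halts (run_state (encode p) x k)"
proof (induction p arbitrary: x y k)
  case (Tuple p q)
  then obtain a b where "eval p x = Some a" "eval q x = Some b" "y = pair a b"
    by (auto split: bind_splits)
  then have "halts (step (ret_state b (push 1 a k)))"
    using Tuple.prems by (simp add: step_push step_ret_def Let_def)
  then have "halts (run_state (encode q) x (push 1 a k))"
    using Tuple.IH(2) halts_step \<open>eval q x = Some b\<close> by blast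
  then have "halts (step (ret_state a (push 0 (pair (encode q) x) k)))"
    by (simp add: step_push step_ret_def Let_def)
  then have "halts (step (run_state (encode (Tuple p q)) x k))"
    unfolding step_encode using Tuple.IH(1) halts_step \<open>eval p x = Some a\<close> by blast
  then show ?case by (rule halts_step)
next
  case (Comp p q)
  then obtain a where "eval q x = Some a" "eval p a = Some y"
    by (auto split: bind_splits)
  then have "halts (step (ret_state a (push 2 (encode p) k)))"
    using Comp.IH(1) Comp.prems by (simp add: step_push step_ret_def Let_def)
  then have "halts (step (run_state (encode (Comp p q)) x k))"
    unfolding step_encode using Comp.IH(2) halts_step \<open>eval q x = Some a\<close> by blast
  then show ?case by (rule halts_step)
next
  case (Rec p q)
  define a where "a = pfst x"
  \<comment> \<open>Loop invariant: \<open>v\<close> is the value at round \<open>m\<close>, and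
    \<open>j\<close> rounds remain.\<close>
  have loop: "rec_value p q a (m + j) = Some y \<Longrightarrow> rec_value p q a m = Some v \<Longrightarrow>
      halts (ret_state v (push 3 (pair (encode q) (pair a (pair m j))) k))" for m j v
  proof (induction j arbitrary: m v)
    case 0
    then have "halts (step (ret_state v (push 3 (pair (encode q) (pair a (pair m 0))) k)))"
      using Rec.prems by (simp add: step_push step_ret_def Let_def)
    then show ?case by (rule halts_step)
  next
    case (Suc j)
    have eq: "rec_value p q a (Suc m) = eval q (pair a (pair m v))"
      using Suc.prems(2) by simp
    moreover have "rec_value p q a (Suc m) \<noteq> None"
      using rec_value_add_None[of p a q "Suc m" j] Suc.prems(1) by auto
    ultimately obtain u where u: "eval q (pair a (pair m v)) = Some u" by auto
    have "halts (ret_state u (push 3 (pair (encode q) (pair a (pair (Suc m) j))) k))"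
      using Suc.prems(1) eq u by (intro Suc.IH) auto
    then have "halts (step (ret_state v (push 3 (pair (encode q) (pair a (pair m (Suc j)))) k)))"
      using Rec.IH(2)[OF u] by (simp add: step_push step_ret_def Let_def)
    then show ?case by (rule halts_step)
  qed
  have y: "rec_value p q a (0 + psnd x) = Some y"
    using Rec.prems(1) by (simp add: a_def case_prod_beta)
  then obtain v where "eval p a = Some v"
    using rec_value_add_None[of p a q 0 "psnd x"] by fastforce
  then have "halts (step (run_state (encode (Rec p q)) x k))"
    unfolding step_encode a_def[symmetric] using loop[OF y] Rec.IH(1) by simp
  then show ?case by (rule halts_step)
next
  case (Mu p)
  let ?P = "\<lambda>n. eval p (pair x n) = Some 0 \<and> (\<forall>m<n. eval p (pair x m) \<noteq> None)"
  have ex: "\<exists>n. ?P n" and y_def: "y = (LEAST n. ?P n)"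
    using Mu.prems(1) by (auto simp: Let_def split: if_splits)
  have y: "?P y" unfolding y_def by (rule LeastI_ex[of ?P, OF ex])
  have least: "y \<le> n" if "?P n" for n
    unfolding y_def using that by (rule Least_le[of ?P])
  \<comment> \<open>Downward induction from the least zero \<open>y\<close>: the tests below it
    return nonzero values, so halting from test \<open>m\<close> reduces to halting from test
    \<open>Suc m\<close>.\<close>
  have "halts (run_state (encode p) (pair x m) (push 4 (pair (encode p) (pair x m)) k))"
    if "m \<le> y" for m
    using that
  proof (induction m rule: inc_induct)
    case base
    have "halts (step (ret_state 0 (push 4 (pair (encode p) (pair x y)) k)))"
      using Mu.prems by (simp add: step_push step_ret_def Let_def)
    from halts_step[OF this] show ?case using y by (intro Mu.IH[of _ 0]) auto
  next
    case (step m)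
    obtain v where v: "eval p (pair x m) = Some v" using y step.hyps by blast
    have "\<not> ?P m" using least[of m] step.hyps by (meson not_less)
    moreover have "\<forall>l<m. eval p (pair x l) \<noteq> None" using y step.hyps by (meson less_trans)
    ultimately have "v \<noteq> 0" using v by metis
    then have "halts (step (ret_state v (push 4 (pair (encode p) (pair x m)) k)))"
      using step.IH by (simp add: step_push step_ret_def Let_def)
    from halts_step[OF this] show ?case using v by (intro Mu.IH[of _ v]) auto
  qed
  from this[of 0] have "halts (step (run_state (encode (Mu p)) x k))"
    unfolding step_encode by simp
  then show ?case by (rule halts_step)
qed (auto intro!: halts_step[of "run_state _ _ _"] simp: step_encode simp del: encode.simps)

text \<open>Converse of \<open>halts_run\<close>, with step counts. The loss of at least one step is
  recorded because the loop of \<open>Mu\<close> has no bound known in advance and is unrolled by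
  induction on the step count.\<close>

lemma halts_in_run:
  "halts_in n (run_state (encode p) x k) \<Longrightarrow>
     \<exists>y. eval p x = Some y \<and> 0 < n \<and> halts_in (n - 1) (ret_state y k)"
proof (induction p arbitrary: x k n)
  case (Tuple p q)
  from halts_in_runD[OF Tuple.prems]
  have "0 < n" "halts_in (n - 1) (run_state (encode p) x (push 0 (pair (encode q) x) k))"
    unfolding step_encode by auto
  with Tuple.IH(1) obtain a where a: "eval p x = Some a"
    "halts_in (n - 1 - 1) (ret_state a (push 0 (pair (encode q) x) k))" by blast
  from halts_in_pushD[OF a(2)]
  have "halts_in (n - 1 - 1 - 1) (run_state (encode q) x (push 1 a k))"
    by (simp add: step_ret_def Let_def)
  with Tuple.IH(2) obtain b where b: "eval q x = Some b"
    "halts_in (n - 1 - 1 - 1 - 1) (ret_state b (push 1 a k))" by blast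
  from halts_in_pushD[OF b(2)]
  have "halts_in (n - 1 - 1 - 1 - 1 - 1) (ret_state (pair a b) k)"
    by (simp add: step_ret_def Let_def)
  then have "halts_in (n - 1) (ret_state (pair a b) k)" by (rule halts_in_mono) simp
  then show ?case using a(1) b(1) \<open>0 < n\<close> by simp
next
  case (Comp p q)
  from halts_in_runD[OF Comp.prems]
  have "0 < n" "halts_in (n - 1) (run_state (encode q) x (push 2 (encode p) k))"
    unfolding step_encode by auto
  with Comp.IH(2) obtain a where a: "eval q x = Some a"
    "halts_in (n - 1 - 1) (ret_state a (push 2 (encode p) k))" by blast
  from halts_in_pushD[OF a(2)]
  have "halts_in (n - 1 - 1 - 1) (run_state (encode p) a k)"
    by (simp add: step_ret_def Let_def)
  with Comp.IH(1) obtain b where b: "eval p a = Some b"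
    "halts_in (n - 1 - 1 - 1 - 1) (ret_state b k)" by blast
  from b(2) have "halts_in (n - 1) (ret_state b k)" by (rule halts_in_mono) simp
  then show ?case using a(1) b(1) \<open>0 < n\<close> by simp
next
  case (Rec p q)
  define a where "a = pfst x"
  have loop: "halts_in i (ret_state v (push 3 (pair (encode q) (pair a (pair m j))) k)) \<Longrightarrow>
      rec_value p q a m = Some v \<Longrightarrow>
      \<exists>y. rec_value p q a (m + j) = Some y \<and> halts_in i (ret_state y k)" for i m j v
  proof (induction j arbitrary: i m v)
    case 0
    from halts_in_pushD[OF 0(1)] have "halts_in (i - 1) (ret_state v k)"
      by (simp add: step_ret_def Let_def)
    then have "halts_in i (ret_state v k)" by (rule halts_in_mono) simp
    then show ?case using 0(2) by simp
  next
    case (Suc j)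
    from halts_in_pushD[OF Suc.prems(1)]
    have "halts_in (i - 1) (run_state (encode q) (pair a (pair m v))
        (push 3 (pair (encode q) (pair a (pair (Suc m) j))) k))"
      by (simp add: step_ret_def Let_def)
    with Rec.IH(2) obtain u where u: "eval q (pair a (pair m v)) = Some u"
      "halts_in (i - 1 - 1) (ret_state u (push 3 (pair (encode q) (pair a (pair (Suc m) j))) k))"
      by blast
    then obtain y where "rec_value p q a (Suc m + j) = Some y"
      and y: "halts_in (i - 1 - 1) (ret_state y k)"
      using Suc.IH[OF u(2)] Suc.prems(2) by auto
    moreover from y have "halts_in i (ret_state y k)" by (rule halts_in_mono) simp
    ultimately show ?case by auto
  qed
  from halts_in_runD[OF Rec.prems]
  have "0 < n" "halts_in (n - 1) (run_state (encode p) a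
      (push 3 (pair (encode q) (pair a (pair 0 (psnd x)))) k))"
    unfolding step_encode a_def by auto
  with Rec.IH(1) obtain v where v: "eval p a = Some v"
    "halts_in (n - 1 - 1) (ret_state v (push 3 (pair (encode q) (pair a (pair 0 (psnd x)))) k))"
    by blast
  then obtain y where y: "rec_value p q a (0 + psnd x) = Some y" "halts_in (n - 1 - 1) (ret_state y k)"
    using loop[OF v(2)] by auto
  from y(2) have "halts_in (n - 1) (ret_state y k)" by (rule halts_in_mono) simp
  moreover have "eval (Rec p q) x = Some y"
    using y(1) by (simp add: a_def case_prod_beta)
  ultimately show ?case using \<open>0 < n\<close> by blast
next
  case (Mu p)
  let ?P = "\<lambda>n. eval p (pair x n) = Some 0 \<and> (\<forall>m<n. eval p (pair x m) \<noteq> None)"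
  \<comment> \<open>A nonzero test value starts the next test with a smaller step budget
    \<open>i\<close>; the search must therefore reach a zero \<open>j\<close>, and all tests from
    \<open>m\<close> up to it are defined and nonzero.\<close>
  have loop: "halts_in i (run_state (encode p) (pair x m) (push 4 (pair (encode p) (pair x m)) k)) \<Longrightarrow>
      \<exists>j\<ge>m. eval p (pair x j) = Some 0 \<and>
        (\<forall>l. m \<le> l \<and> l < j \<longrightarrow> eval p (pair x l) \<noteq> None \<and> eval p (pair x l) \<noteq> Some 0) \<and>
        halts_in i (ret_state j k)" for i m
  proof (induction i arbitrary: m rule: less_induct)
    case (less i)
    from Mu.IH[OF less.prems] obtain v where v: "eval p (pair x m) = Some v" "0 < i"
      "halts_in (i - 1) (ret_state v (push 4 (pair (encode p) (pair x m)) k))" by blast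
    show ?case
    proof (cases "v = 0")
      case True
      then have "halts_in (i - 1 - 1) (ret_state m k)"
        using halts_in_pushD[OF v(3)] by (simp add: step_ret_def Let_def)
      then have "halts_in i (ret_state m k)" by (rule halts_in_mono) simp
      then show ?thesis using v True by (intro exI[of _ m]) auto
    next
      case False
      then have "halts_in (i - 1 - 1) (run_state (encode p) (pair x (Suc m))
          (push 4 (pair (encode p) (pair x (Suc m))) k))"
        using halts_in_pushD[OF v(3)] by (simp add: step_ret_def Let_def)
      with less.IH[of "i - 1 - 1" "Suc m"] v(2)
      obtain j where j: "Suc m \<le> j" "eval p (pair x j) = Some 0"
        "\<forall>l. Suc m \<le> l \<and> l < j \<longrightarrow> eval p (pair x l) \<noteq> None \<and> eval p (pair x l) \<noteq> Some 0"
        "halts_in (i - 1 - 1) (ret_state j k)"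
        by auto
      from j(4) have "halts_in i (ret_state j k)" by (rule halts_in_mono) simp
      moreover have "\<forall>l. m \<le> l \<and> l < j \<longrightarrow> eval p (pair x l) \<noteq> None \<and> eval p (pair x l) \<noteq> Some 0"
        using j(3) v(1) False by (metis not_less_eq_eq option.distinct(1) option.inject le_antisym)
      ultimately show ?thesis using j(1,2) by (intro exI[of _ j]) auto
    qed
  qed
  from halts_in_runD[OF Mu.prems]
  have "0 < n"
    "halts_in (n - 1) (run_state (encode p) (pair x 0) (push 4 (pair (encode p) (pair x 0)) k))"
    unfolding step_encode by auto
  from loop[OF this(2)] obtain j where j: "eval p (pair x j) = Some 0"
    "\<And>l. l < j \<Longrightarrow> eval p (pair x l) \<noteq> None \<and> eval p (pair x l) \<noteq> Some 0"
    "halts_in (n - 1) (ret_state j k)"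
    by auto
  then have "?P j" by blast
  moreover have "(LEAST n. ?P n) = j"
    using j(1,2) by (intro Least_equality) (auto simp: not_less[symmetric])
  ultimately have "eval (Mu p) x = Some j"
    unfolding eval.simps Let_def by (metis (mono_tags, lifting))
  then show ?case using j(3) \<open>0 < n\<close> by blast
qed (drule halts_in_runD, simp add: step_encode del: encode.simps)+

lemma encode_decode: "encode (decode e) = e"
  unfolding decode_def by (rule surj_f_inv_f[OF surj_encode])

lemma mem_W_iff: "x \<in> W e \<longleftrightarrow> (\<exists>n. halts_in n (run_state e x 0))"
proof
  assume "x \<in> W e"
  then obtain y where y: "eval (decode e) x = Some y" unfolding W_def by auto
  have "halts_in 0 (ret_state y 0)" by (simp add: halts_in_0 ret_state_def)
  then have "halts (ret_state y 0)" unfolding halts_def by blast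
  from halts_run[OF y this] show "\<exists>n. halts_in n (run_state e x 0)"
    by (simp add: halts_def encode_decode)
next
  assume "\<exists>n. halts_in n (run_state e x 0)"
  then have "\<exists>y. eval (decode e) x = Some y" using halts_in_run encode_decode by metis
  then show "x \<in> W e" unfolding W_def by auto
qed

text \<open>The numbers \<open>\<langle>x, s\<rangle>\<close> with \<open>enum e \<langle>x, s\<rangle>\<close> form an effective enumeration of \<open>W e\<close>, uniformly
  in \<open>e\<close>.\<close>

definition enum :: "nat \<Rightarrow> nat \<Rightarrow> bool" where
  "enum e t \<longleftrightarrow> halts_in (psnd t) (run_state e (pfst t) 0)"

lemma mem_W_enum: "x \<in> W e \<longleftrightarrow> (\<exists>t. enum e t \<and> pfst t = x)"
proof
  assume "x \<in> W e"
  then obtain n where "enum e (pair x n)" unfolding mem_W_iff enum_def by auto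
  then show "\<exists>t. enum e t \<and> pfst t = x" by fastforce
qed (auto simp: mem_W_iff enum_def)

text \<open>Universality enters here: the index may vary with the input, because all programs are
  run by iterating the single computable function \<open>step\<close>.\<close>

lemma decidable_enum:
  assumes "computable e" "computable t"
  shows "decidable (\<lambda>x. enum (e x) (t x))"
proof -
  have it: "(step ^^ n) w = rec_nat w (\<lambda>m y. step y) n" for n w by (induction n) auto
  have "computable (\<lambda>z. step (psnd (psnd z)))"
    by (intro computable_comp[OF computable_step] computable_intros)
  then show ?thesis
    unfolding enum_def halts_in_def it
    by (intro computable_intros computable_rec_nat computable_run_state assms)
qed

section \<open>Search and parametrization\<close>

lemma search_program:
  assumes "decidable (\<lambda>z. P (pfst z) (psnd z))"
  shows "\<exists>p. \<forall>x. eval p x = (if \<exists>n. P x n then Some (LEAST n. P x n) else None)"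
proof -
  \<comment> \<open>\<open>Mu\<close> looks for a zero, so the characteristic function of the
    negation is searched; being total, it never blocks the search.\<close>
  obtain r where r: "\<And>z. eval r z = Some (of_bool (\<not> P (pfst z) (psnd z)))"
    using decidable_not[OF assms] unfolding decidable_def computable_iff by blast
  have "eval (Mu r) x = (if \<exists>n. P x n then Some (LEAST n. P x n) else None)" for x
    by (simp add: r Let_def)
  then show ?thesis by blast
qed

lemma computable_Least:
  assumes "decidable (\<lambda>z. P (pfst z) (psnd z))" "\<And>x. \<exists>n. P x n"
  shows "computable (\<lambda>x. LEAST n. P x n)"
proof -
  obtain p where "\<And>x. eval p x = (if \<exists>n. P x n then Some (LEAST n. P x n) else None)"
    using search_program[OF assms(1)] by blast
  then have "\<forall>x. eval p x = Some (LEAST n. P x n)" using assms(2) by presburger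
  then show ?thesis unfolding computable_iff by blast
qed

lemma partial_computable_Least:
  assumes "decidable (\<lambda>z. P (pfst z) (psnd z))" "computable f"
  shows "partial_computable
    (\<lambda>x. if \<exists>n. P x n then Some (f (pair x (LEAST n. P x n))) else None)"
proof -
  obtain p q where p: "\<And>x. eval p x = (if \<exists>n. P x n then Some (LEAST n. P x n) else None)"
    and q: "\<And>x. eval q x = Some (f x)"
    using search_program[OF assms(1)] assms(2) unfolding computable_iff by blast
  have "eval (Comp q (Tuple (Tuple Left Right) p)) =
      (\<lambda>x. if \<exists>n. P x n then Some (f (pair x (LEAST n. P x n))) else None)"
    by (rule ext) (simp add: p q)
  from this[symmetric] show ?thesis unfolding partial_computable_def by (rule exI)
qed

lemma computable_times4:
  assumes "computable f"
  shows "computable (\<lambda>x. 4 * f x)"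
proof -
  have "computable (\<lambda>x. f x + f x + (f x + f x))" by (intro computable_add assms)
  moreover have "4 * n = n + n + (n + n)" for n :: nat by simp
  ultimately show ?thesis by presburger
qed

lemma W_encode: "W (encode p) = dom (eval p)"
  by (simp add: W_def decode_def inv_f_f[OF inj_encode])

lemma computable_encode_const_prog: "computable (\<lambda>n. encode (const_prog n))"
proof -
  \<comment> \<open>Here 0 and 1 are the codes of \<open>Zero\<close> and \<open>Succ\<close>, and
    the offset 5 belongs to \<open>Comp\<close>.\<close>
  have "encode (const_prog n) = rec_nat 0 (\<lambda>m y. 4 * pair 1 y + 5) n" for n
    by (induction n) auto
  moreover have "computable (\<lambda>n. rec_nat 0 (\<lambda>m y. 4 * pair 1 y + 5) n)"
    by (intro computable_rec_nat computable_times4 computable_intros)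
  ultimately show ?thesis by simp
qed

text \<open>An s-m-n theorem: the parameter \<open>e\<close> is built into the program by
  \<open>const_prog\<close>, and the code of the result is computable from \<open>e\<close>.\<close>

lemma parametrized_ce:
  assumes "decidable (\<lambda>z. R (pfst (pfst z)) (psnd (pfst z)) (psnd z))"
  shows "\<exists>f. computable f \<and> (\<forall>e. W (f e) = {x. \<exists>s. R e x s})"
proof -
  obtain p where p: "\<And>y. eval p y =
      (if \<exists>n. R (pfst y) (psnd y) n then Some (LEAST n. R (pfst y) (psnd y) n) else None)"
    using search_program[of "\<lambda>y. R (pfst y) (psnd y)"] assms by blast
  define f where "f e = encode (Comp p (Tuple (const_prog e) (Tuple Left Right)))" for e
  have "computable f"
    unfolding f_def encode.simps
    by (intro computable_times4 computable_encode_const_prog computable_intros)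
  moreover have "W (f e) = {x. \<exists>s. R e x s}" for e
    by (auto simp: f_def W_encode p eval_const_prog simp del: encode.simps split: if_splits)
  ultimately show ?thesis by blast
qed

lemma ce_Collect_ex:
  assumes "decidable (\<lambda>z. R (pfst z) (psnd z))"
  shows "ce {x. \<exists>s. R x s}"
proof -
  obtain p where p: "\<And>x. eval p x = (if \<exists>n. R x n then Some (LEAST n. R x n) else None)"
    using search_program[OF assms] by blast
  have "W (encode p) = {x. \<exists>s. R x s}"
    by (auto simp: W_encode p split: if_splits)
  then show ?thesis unfolding ce_def by metis
qed

section \<open>The counterexample\<close>

text \<open>Besides the whole set \<open>base 0\<close> and the limit \<open>base 1\<close>, the points are the finite sets
  \<open>base (2 * n) = {1, 3, \<dots>, 2 * n - 1, 2 * n}\<close> with \<open>0 < n\<close>, which approach \<open>base 1\<close> as \<open>n\<close> grows.\<close>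

definition base :: "nat \<Rightarrow> nat set" where
  "base x = {z. x = 0 \<or> z = x \<or> odd z \<and> (odd x \<or> z < x)}"

text \<open>The threshold \<open>4 * e + 3\<close> grows fast enough to leave infinitely many even
  numbers outside \<open>post\<close>. Being odd, it lies in the limit, but in no
  \<open>base x\<close> with \<open>x\<close> even and \<open>0 < x < 4 * e + 3\<close>.\<close>

definition marker :: "nat \<Rightarrow> nat \<Rightarrow> bool" where
  "marker e t \<longleftrightarrow> enum e t \<and> even (pfst t) \<and> 4 * e + 3 < pfst t"

definition first_marker :: "nat \<Rightarrow> nat \<Rightarrow> bool" where
  "first_marker e t \<longleftrightarrow> marker e t \<and> (\<forall>i<t. \<not> marker e i)"

text \<open>Post's simple set, formed inside the even numbers.\<close>

definition post :: "nat set" where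
  "post = {x. \<exists>e t. first_marker e t \<and> x = pfst t}"

definition points :: "nat set set" where
  "points = base ` (- post)"

lemma base_0: "base 0 = UNIV"
  by (simp add: base_def)

lemma base_odd: "odd x \<Longrightarrow> base x = Collect odd"
  by (auto simp: base_def)

lemma post_even: "x \<in> post \<Longrightarrow> even x \<and> 0 < x"
  by (auto simp: post_def first_marker_def marker_def)

lemma UNIV_in_points: "UNIV \<in> points"
  unfolding points_def using post_even base_0 by blast

lemma odds_in_points: "Collect odd \<in> points"
proof -
  have "1 \<notin> post" using post_even[of 1] by auto
  then have "base 1 \<in> points" unfolding points_def by blast
  then show ?thesis by (simp add: base_odd)
qed

lemma first_marker_Least: "first_marker e t \<Longrightarrow> t = (LEAST t. marker e t)"
  unfolding first_marker_def by (metis Least_equality not_less)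

text \<open>An even number below \<open>4 * N + 2\<close> can only enter \<open>post\<close> on behalf of one of the \<open>N\<close> indices
  below \<open>N\<close>, each of which contributes at most once.\<close>

lemma even_not_in_post_above: "\<exists>n\<ge>N. 2 * n \<notin> post"
proof (rule ccontr)
  assume "\<not> ?thesis"
  then have *: "2 * n \<in> post" if "N \<le> n" for n using that by blast
  \<comment> \<open>Pigeonhole: these \<open>N + 1\<close> even numbers would have to come from
    \<open>N\<close> indices, since \<open>4 * e + 3 < x\<close> and \<open>x \<le> 4 * N\<close>
    force \<open>e < N\<close>.\<close>
  have "(*) 2 ` {N..2 * N} \<subseteq> (\<lambda>e. pfst (LEAST t. marker e t)) ` {..<N}"
  proof
    fix x assume "x \<in> (*) 2 ` {N..2 * N}"
    then have "x \<in> post" "x \<le> 4 * N" using * by auto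
    then obtain e t where t: "first_marker e t" "x = pfst t" unfolding post_def by auto
    then have "4 * e + 3 < x" unfolding first_marker_def marker_def by simp
    then have "e < N" using \<open>x \<le> 4 * N\<close> by simp
    then show "x \<in> (\<lambda>e. pfst (LEAST t. marker e t)) ` {..<N}"
      using t first_marker_Least by auto
  qed
  then have "card ((*) 2 ` {N..2 * N}) \<le> card ((\<lambda>e. pfst (LEAST t. marker e t)) ` {..<N})"
    by (intro card_mono) auto
  also have "\<dots> \<le> N" using card_image_le[of "{..<N}"] by fastforce
  also have "card ((*) 2 ` {N..2 * N}) = Suc N"
    by (subst card_image) (auto simp: inj_on_def)
  finally show False by simp
qed

text \<open>A finite point \<open>base x\<close> has only indices \<open>e\<close> with \<open>x < 4 * e + 3\<close>: the first marker found in
  \<open>W e\<close> would otherwise be \<open>x\<close>, putting \<open>x\<close> into \<open>post\<close>.\<close>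

lemma threshold_not_in_W:
  assumes "W e = base x" "x \<notin> post" "even x" "0 < x"
  shows "4 * e + 3 \<notin> W e"
proof
  assume "4 * e + 3 \<in> W e"
  then have "4 * e + 3 < x"
    using assms by (auto simp: base_def)
  have "x \<in> W e" using assms(1) by (simp add: base_def)
  then obtain t where "enum e t" "pfst t = x" unfolding mem_W_enum by blast
  then have "\<exists>t. marker e t"
    unfolding marker_def using assms(3) \<open>4 * e + 3 < x\<close> by blast
  define t0 where "t0 = (LEAST t. marker e t)"
  have t0: "first_marker e t0"
    unfolding first_marker_def t0_def
    using \<open>\<exists>t. marker e t\<close> by (meson LeastI_ex not_less_Least)
  then have "pfst t0 \<in> base x" "even (pfst t0)"
    unfolding assms(1)[symmetric] mem_W_enum first_marker_def marker_def by auto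
  \<comment> \<open>The only even element of \<open>base x\<close> is \<open>x\<close>
    itself.\<close>
  then have "pfst t0 = x" using assms(4) by (auto simp: base_def)
  then have "x \<in> post" unfolding post_def using t0 by blast
  then show False using assms(2) by blast
qed

text \<open>The point obtained from a guess \<open>x\<close> for \<open>W e = base x\<close>; it is the whole set as soon as
  the guess is refuted or \<open>base x\<close> turns out not to be a point.\<close>

definition repair :: "nat \<Rightarrow> nat \<Rightarrow> nat set" where
  "repair e x = base x \<union> {z. x \<in> post \<or> \<not> W e \<subseteq> base x}"

text \<open>Valid for arbitrary \<open>e\<close> and \<open>x\<close>: this yields condition (i) of
  a wn-family and makes \<open>repair\<close> a total numbering.\<close>

lemma repair_in_points: "repair e x \<in> points"
proof (cases "x \<in> post \<or> \<not> W e \<subseteq> base x")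
  case True
  then have "repair e x = UNIV" unfolding repair_def by auto
  then show ?thesis using UNIV_in_points by simp
next
  case False
  then show ?thesis unfolding repair_def points_def by auto
qed

text \<open>The enumerated element \<open>pfst t\<close> is itself the guess \<open>x\<close>. An
  odd guess stands for the limit, as \<open>base\<close> takes the same value at all odd
  numbers.\<close>

definition trigger :: "nat \<Rightarrow> nat \<Rightarrow> bool" where
  "trigger e t \<longleftrightarrow> enum e t \<and> (even (pfst t) \<or> pfst t = 4 * e + 3)"

text \<open>The whole set refutes every smaller guess. The limit has no even elements and thus
  triggers an odd guess. A finite point cannot show \<open>4 * e + 3\<close>, by
  \<open>threshold_not_in_W\<close>, so it triggers through its only even element.\<close>

lemma repair_trigger:
  assumes "W e \<in> points" "trigger e t"
  shows "repair e (pfst t) = W e"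
proof -
  define x where "x = pfst t"
  have x: "x \<in> W e" "even x \<or> x = 4 * e + 3"
    using assms(2) unfolding trigger_def mem_W_enum x_def by auto
  obtain y where y: "W e = base y" "y \<notin> post" using assms(1) unfolding points_def by blast
  consider "y = 0" | "odd y" | "even y" "0 < y" by blast
  then have "repair e x = W e"
  proof cases
    case 1
    then show ?thesis using y by (auto simp: repair_def base_0)
  next
    case 2
    then have "odd x" using x y base_odd by auto
    then show ?thesis using 2 y post_even by (auto simp: repair_def base_odd)
  next
    case 3
    then have "even x" using x threshold_not_in_W[OF y] by blast
    then have "x = y" using x(1) y 3 by (auto simp: base_def)
    then show ?thesis using y by (auto simp: repair_def)
  qed
  then show ?thesis unfolding x_def .
qed

lemma trigger_exists:
  assumes "W e \<in> points"
  shows "\<exists>t. trigger e t"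
proof -
  obtain y where y: "W e = base y" using assms unfolding points_def by blast
  have "y \<in> W e" "odd y \<Longrightarrow> 4 * e + 3 \<in> W e" using y by (auto simp: base_def)
  then show ?thesis unfolding trigger_def mem_W_enum by (cases "even y") blast+
qed

section \<open>Uniform enumeration of the repaired sets\<close>

lemma decidable_base:
  assumes "computable f" "computable g"
  shows "decidable (\<lambda>z. f z \<in> base (g z))"
  unfolding base_def mem_Collect_eq by (intro computable_intros assms)

lemma decidable_marker:
  assumes "computable f" "computable g"
  shows "decidable (\<lambda>z. marker (f z) (g z))"
proof -
  have "decidable (\<lambda>z. enum (f z) (g z) \<and> \<not> odd (pfst (g z)) \<and> 4 * f z + 3 < pfst (g z))"
    by (intro decidable_enum computable_times4 computable_intros assms)
  then show ?thesis by (simp add: marker_def)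
qed

lemma decidable_first_marker:
  assumes "computable f" "computable g"
  shows "decidable (\<lambda>z. first_marker (f z) (g z))"
  unfolding first_marker_def
  by (intro decidable_conj decidable_marker decidable_ball_less decidable_not assms
      computable_comp[OF assms(1)] computable_psnd computable_pfst computable_id)

lemma decidable_trigger:
  assumes "computable f" "computable g"
  shows "decidable (\<lambda>z. trigger (f z) (g z))"
proof -
  have "decidable (\<lambda>z. enum (f z) (g z) \<and> (\<not> odd (pfst (g z)) \<or> pfst (g z) = 4 * f z + 3))"
    by (intro decidable_enum computable_times4 computable_intros assms)
  then show ?thesis by (simp add: trigger_def)
qed

lemma repair_parametrization:
  "\<exists>f. computable f \<and> (\<forall>z. W (f z) = repair (pfst z) (psnd z))"
proof -
  \<comment> \<open>The certificate \<open>s\<close> is read in two ways: as an index with its first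
    marker, showing that the guess enters \<open>post\<close>, or as a stage at which
    \<open>W (pfst z)\<close> leaves the guessed set.\<close>
  define R where "R z x s \<longleftrightarrow> x \<in> base (psnd z) \<or>
    first_marker (pfst s) (psnd s) \<and> psnd z = pfst (psnd s) \<or>
    enum (pfst z) s \<and> pfst s \<notin> base (psnd z)" for z x s
  have "decidable (\<lambda>z. R (pfst (pfst z)) (psnd (pfst z)) (psnd z))"
    unfolding R_def
    by (intro decidable_base decidable_first_marker decidable_enum computable_intros)
  moreover have "{x. \<exists>s. R z x s} = repair (pfst z) (psnd z)" for z
  proof -
    have "psnd z \<in> post \<longleftrightarrow> (\<exists>s. first_marker (pfst s) (psnd s) \<and> psnd z = pfst (psnd s))"
      unfolding post_def mem_Collect_eq by (metis fst_conv prod_encode_inverse snd_conv)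
    moreover have "\<not> W (pfst z) \<subseteq> base (psnd z) \<longleftrightarrow>
        (\<exists>s. enum (pfst z) s \<and> pfst s \<notin> base (psnd z))"
      unfolding subset_iff mem_W_enum by blast
    ultimately show ?thesis unfolding R_def repair_def by blast
  qed
  ultimately show ?thesis using parametrized_ce[of R] by simp
qed

section \<open>The topological space\<close>

definition nbhd :: "nat \<Rightarrow> nat set set" where
  "nbhd n = {A \<in> points. n \<in> A}"

definition nbhd_topology :: "nat set topology" where
  "nbhd_topology = topology (arbitrary union_of (\<lambda>U. U \<in> range nbhd))"

text \<open>A point containing \<open>j\<close> contains every odd number below \<open>j\<close>,
  while a point containing an even number and a larger one is the whole set, the only point
  containing 0.\<close>

definition meet :: "nat \<Rightarrow> nat \<Rightarrow> nat" where
  "meet i j = (if i = j then i else if i < j then if odd i then j else 0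
     else if odd j then i else 0)"

lemma nbhd_Int: "nbhd i \<inter> nbhd j = nbhd (meet i j)"
proof -
  have "i \<in> base x \<and> j \<in> base x \<longleftrightarrow> meet i j \<in> base x" for x
    by (auto simp: base_def meet_def)
  then show ?thesis unfolding nbhd_def points_def by auto
qed

lemma nbhd_1: "nbhd 1 = points"
proof -
  have "1 \<in> base x" for x by (auto simp: base_def)
  then show ?thesis unfolding nbhd_def points_def by auto
qed

lemma openin_nbhd_topology:
  "openin nbhd_topology = arbitrary union_of (\<lambda>U. U \<in> range nbhd)"
  unfolding nbhd_topology_def
  by (intro topology_inverse' istopology_base) (auto simp: nbhd_Int)

lemma openin_nbhd: "openin nbhd_topology (nbhd n)"
  unfolding openin_nbhd_topology by (rule arbitrary_union_of_inc) simp

lemma topspace_nbhd_topology: "topspace nbhd_topology = points"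
proof
  show "points \<subseteq> topspace nbhd_topology"
    using openin_nbhd[of 1] openin_subset nbhd_1 by metis
  have "openin nbhd_topology (topspace nbhd_topology)" by simp
  then show "topspace nbhd_topology \<subseteq> points"
    unfolding openin_nbhd_topology union_of_def nbhd_def by auto
qed

text \<open>Each point is its own set of base indices, so the conditions on numberings and on the
  wn-family become statements about \<open>points\<close>.\<close>

lemma base_indices_nbhd: "A \<in> points \<Longrightarrow> base_indices nbhd A = A"
  by (simp add: base_indices_def nbhd_def)

lemma ce_points: "A \<in> points \<Longrightarrow> ce A"
proof -
  assume "A \<in> points"
  then obtain x where "A = base x" unfolding points_def by blast
  moreover have "ce {z. \<exists>s::nat. z \<in> base x}"
    by (intro ce_Collect_ex decidable_base computable_intros)
  ultimately show "ce A" by simp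
qed

lemma computable_points_nbhd: "computable_points nbhd_topology nbhd = points"
  unfolding computable_points_def topspace_nbhd_topology
  using ce_points base_indices_nbhd by auto

lemma point_family_nbhd: "point_family nbhd_topology nbhd = points"
  unfolding point_family_def computable_points_nbhd using base_indices_nbhd by force

lemma effectively_enumerable_nbhd: "effectively_enumerable nbhd_topology nbhd"
  unfolding effectively_enumerable_def
proof (intro conjI openin_nbhd_topology)
  have "computable (\<lambda>z. meet (pfst z) (pfst (psnd z)))"
    unfolding meet_def by (intro computable_intros)
  then have "computable3 (\<lambda>i j n. meet i j)"
    unfolding computable3_def
    by (intro exI[of _ "\<lambda>z. meet (pfst z) (pfst (psnd z))"]) simp
  then show "\<exists>g. computable3 g \<and> (\<forall>i j. nbhd i \<inter> nbhd j = (\<Union>n. nbhd (g i j n)))"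
    using nbhd_Int by (intro exI[of _ "\<lambda>i j n. meet i j"]) auto
  have "{i. nbhd i \<noteq> {}} = UNIV" unfolding nbhd_def using UNIV_in_points by auto
  then show "ce {i. nbhd i \<noteq> {}}" using ce_points[OF UNIV_in_points] by simp
qed

lemma t0_space_nbhd: "t0_space nbhd_topology"
  unfolding t0_space_def topspace_nbhd_topology
proof (intro ballI impI)
  fix A B assume "A \<in> points" "B \<in> points" "A \<noteq> B"
  then obtain n where "n \<in> A \<longleftrightarrow> n \<notin> B" by blast
  then show "\<exists>U. openin nbhd_topology U \<and> (A \<notin> U) = (B \<in> U)"
    using \<open>A \<in> points\<close> \<open>B \<in> points\<close> openin_nbhd[of n]
    by (intro exI[of _ "nbhd n"]) (auto simp: nbhd_def)
qed

section \<open>The wn-property and the failure of Rice-Shapiro\<close>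

lemma decidable_trigger_pair: "decidable (\<lambda>z. trigger (pfst z) (psnd z))"
  by (intro decidable_trigger computable_intros)

lemma wn_family_points: "wn_family points"
proof -
  obtain f where f: "computable f" "\<And>z. W (f z) = repair (pfst z) (psnd z)"
    using repair_parametrization by blast
  \<comment> \<open>The argument has the form \<open>pair e t\<close> delivered by the search; the
    guess is the first component of the trigger \<open>t\<close>.\<close>
  define g where "g z = f (pair (pfst z) (pfst (psnd z)))" for z
  have g: "computable g"
    unfolding g_def by (intro computable_comp[OF f(1)] computable_intros)
  have W_g: "W (g (pair e t)) = repair e (pfst t)" for e t by (simp add: g_def f(2))
  define \<sigma> where
    "\<sigma> e = (if \<exists>t. trigger e t then Some (g (pair e (LEAST t. trigger e t))) else None)" for e
  have "partial_computable \<sigma>"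
    unfolding \<sigma>_def by (rule partial_computable_Least[OF decidable_trigger_pair g])
  moreover have "W m \<in> points" if "\<sigma> n = Some m" for n m
    using that W_g repair_in_points unfolding \<sigma>_def by (auto split: if_splits)
  moreover have "\<exists>m. \<sigma> n = Some m \<and> W m = W n" if "W n \<in> points" for n
    using that trigger_exists[OF that] LeastI_ex[of "trigger n"] W_g repair_trigger
    unfolding \<sigma>_def by simp
  ultimately show ?thesis unfolding wn_family_def using ce_points by blast
qed

theorem theorem4p6:
  "\<exists>(X :: nat set topology) (\<alpha> :: nat \<Rightarrow> nat set set).
     effectively_enumerable X \<alpha> \<and> t0_space X \<and> wn_family (point_family X \<alpha>) \<and>
     (\<exists>\<gamma> K. principal_computable_numbering X \<alpha> \<gamma> \<and>
       K \<subseteq> computable_points X \<alpha> \<and>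
       ce (index_set \<gamma> K) \<and>
       \<not> effectively_open_in_points X \<alpha> K)"
proof -
  \<comment> \<open>Numbering by all pairs of an index and a guess avoids the search for a trigger,
    which may fail, and so gives a total map.\<close>
  define \<gamma> where "\<gamma> z = repair (pfst z) (psnd z)" for z
  define K where "K = {Collect odd, UNIV :: nat set}"
  obtain f where f: "computable f" "\<And>z. W (f z) = \<gamma> z"
    using repair_parametrization unfolding \<gamma>_def by blast
  have \<gamma>_points: "\<gamma> z \<in> points" for z unfolding \<gamma>_def by (rule repair_in_points)
  \<comment> \<open>From an index of a point a \<open>\<gamma>\<close>-number is found by search;
    this gives surjectivity and principality.\<close>
  have \<gamma>_trigger: "\<gamma> (pair e (pfst (LEAST t. trigger e t))) = W e" if "W e \<in> points" for e
    unfolding \<gamma>_def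
    using repair_trigger[OF that] LeastI_ex[OF trigger_exists[OF that]] by simp
  have "range \<gamma> = points"
  proof (intro equalityI subsetI)
    fix A assume "A \<in> points"
    then obtain e where "A = W e" using ce_points unfolding ce_def by blast
    then show "A \<in> range \<gamma>" using \<gamma>_trigger \<open>A \<in> points\<close> by (metis rangeI)
  qed (use \<gamma>_points in auto)
  then have "computable_numbering nbhd_topology nbhd \<gamma>"
    unfolding computable_numbering_def computable_points_nbhd
    using f base_indices_nbhd[OF \<gamma>_points] by auto
  moreover have "\<exists>h. computable h \<and> \<delta> = \<gamma> \<circ> h"
    if \<delta>: "computable_numbering nbhd_topology nbhd \<delta>" for \<delta>
  proof -
    obtain d where d: "computable d" "\<And>n. base_indices nbhd (\<delta> n) = W (d n)"
      and "range \<delta> = points"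
      using \<delta> unfolding computable_numbering_def computable_points_nbhd by blast
    then have W_d: "W (d n) = \<delta> n" "W (d n) \<in> points" for n
      using base_indices_nbhd by (metis rangeI)+
    \<comment> \<open>The search always ends, because \<open>W (d n)\<close> is a point.\<close>
    define h where "h n = pair (d n) (pfst (LEAST t. trigger (d n) t))" for n
    have "decidable (\<lambda>z. trigger (d (pfst z)) (psnd z))"
      by (intro decidable_trigger computable_comp[OF d(1)] computable_intros)
    then have "computable (\<lambda>n. LEAST t. trigger (d n) t)"
      by (rule computable_Least) (rule trigger_exists[OF W_d(2)])
    then have "computable h"
      unfolding h_def by (intro computable_pair computable_pfst d(1))
    moreover have "\<delta> = \<gamma> \<circ> h"
      using \<gamma>_trigger[OF W_d(2)] W_d(1) by (auto simp: h_def)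
    ultimately show ?thesis by blast
  qed
  ultimately have "principal_computable_numbering nbhd_topology nbhd \<gamma>"
    unfolding principal_computable_numbering_def by blast
  moreover have "K \<subseteq> computable_points nbhd_topology nbhd"
    unfolding K_def computable_points_nbhd using UNIV_in_points odds_in_points by simp
  moreover have "ce (index_set \<gamma> K)"
  proof -
    \<comment> \<open>An odd guess is never in \<open>post\<close> and yields the limit or the whole
      set. An even guess belongs to \<open>\<gamma> z\<close>, which excludes the limit, and the
      whole set is recognized by its element 0.\<close>
    have "\<gamma> z \<in> K \<longleftrightarrow> (\<exists>s. odd (psnd z) \<or> enum (f z) s \<and> pfst s = 0)" for z
    proof -
      have "\<gamma> z \<in> K \<longleftrightarrow> odd (psnd z) \<or> 0 \<in> \<gamma> z"
      proof
        assume "\<gamma> z \<in> K"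
        moreover have "psnd z \<in> \<gamma> z" by (simp add: \<gamma>_def repair_def base_def)
        ultimately show "odd (psnd z) \<or> 0 \<in> \<gamma> z" unfolding K_def by auto
      next
        assume "odd (psnd z) \<or> 0 \<in> \<gamma> z"
        then have "odd (psnd z) \<or> \<gamma> z = UNIV"
          unfolding \<gamma>_def repair_def by (auto simp: base_def)
        then show "\<gamma> z \<in> K"
          using post_even[of "psnd z"] unfolding \<gamma>_def repair_def K_def
          by (cases "W (pfst z) \<subseteq> base (psnd z)") (auto simp: base_odd)
      qed
      then show ?thesis unfolding f(2)[symmetric] mem_W_enum by blast
    qed
    moreover have "ce {z. \<exists>s. odd (psnd z) \<or> enum (f z) s \<and> pfst s = 0}"
      by (intro ce_Collect_ex decidable_enum computable_comp[OF f(1)] computable_intros)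
    ultimately show ?thesis unfolding index_set_def by simp
  qed
  moreover have "\<not> effectively_open_in_points nbhd_topology nbhd K"
  proof
    assume "effectively_open_in_points nbhd_topology nbhd K"
    then obtain V where V: "K = points \<inter> (\<Union>n\<in>V. nbhd n)"
      unfolding effectively_open_in_points_def computable_points_nbhd by blast
    have "Collect odd \<in> K" unfolding K_def by simp
    then obtain v where v: "v \<in> V" "odd v" unfolding V nbhd_def by auto
    \<comment> \<open>Since \<open>v\<close> is odd and \<open>v < 2 * n\<close>, the finite point
      \<open>base (2 * n)\<close> lies in the neighbourhood \<open>nbhd v\<close> of the
      limit.\<close>
    obtain n where n: "v \<le> n" "2 * n \<notin> post" using even_not_in_post_above by blast
    have "0 < n" using v(2) n(1) by (cases v) auto
    have "base (2 * n) \<in> points" using n(2) unfolding points_def by blast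
    moreover have "v \<in> base (2 * n)" using v(2) n(1) \<open>0 < n\<close> by (auto simp: base_def)
    ultimately have "base (2 * n) \<in> K" unfolding V nbhd_def using v(1) by blast
    then consider "base (2 * n) = Collect odd" | "base (2 * n) = UNIV" unfolding K_def by blast
    then show False
    proof cases
      case 1
      have "2 * n \<in> base (2 * n)" by (simp add: base_def)
      then show False unfolding 1 by simp
    next
      case 2
      have "2 * n + 2 \<notin> base (2 * n)" using \<open>0 < n\<close> by (simp add: base_def)
      then show False unfolding 2 by simp
    qed
  qed
  ultimately show ?thesis
    using effectively_enumerable_nbhd t0_space_nbhd wn_family_points point_family_nbhd by metis
qed

end
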